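(* For each type composition $\widehat{n}$ in the list $(2,4)$, $(2,2,2)$, $(1,1,5)$, $(1,2,3)$, $(1,3,2)$, $(2,1,4)$, $(2,4,1)$, $(1,1,1,3)$, $(1,1,3,1)$, $(2,1,2,1)$, $(2,3,1,1)$, $(1,2,2,1)$, $(1,2,1,2)$, $(1,1,2,2)$, $(1,2,1,1,1)$, $(1,1,2,1,1)$, $(1,1,1,2,1)$, $(1,1,1,1,2)$ there exists a non-weighted complete simple game with type composition $\widehat{n}$.
   Context: A simple game is a pair $(v,N)$ with $N$ a finite set (of agents) and $v:2^N\to\{0,1\}$ satisfying $v(\emptyset)=0$, $v(N)=1$, and $v(S)\le v(T)$ for all $S\subseteq T\subseteq N$. For agents $i,j$ write $i\sqsupset j$ if $v(\{i\}\cup S\setminus\{j\})\ge v(S)$ for all $\{j\}\subseteq S\subseteq N\setminus\{i\}$, and $i\,\square\, j$ if both $i\sqsupset j$ and $j\sqsupset i$. A simple game is complete if $\sqsupset$ is a total preorder (reflexive, total, transitive). The relation $\square$ partitions $N$ into equivalence classes $N_1,\dots,N_t$, numbered in order of decreasing desirability (agents in $N_1$ are the most desirable with respect to $\sqsupset$); $t$ is the number of types and $(n_1,\dots,n_t)\in\mathbb{N}_{>0}^t$ with $n_i=|N_i|$ is the type composition of the game. A simple game $(v,N)$ is weighted if there exist weights $w_i\in\mathbb{R}_{\ge 0}$ for $i\in N$ and a quota $q\in\mathbb{R}_{>0}$ such that, for all $S\subseteq N$, $v(S)=1$ if and only if $\sum_{i\in S}w_i\ge q$; otherwise it is non-weighted.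 *)

theory Defs
  imports Complex_Main
begin

definition simple_game :: "('a set \<Rightarrow> nat) \<Rightarrow> 'a set \<Rightarrow> bool" where
  "simple_game v N \<longleftrightarrow>
     finite N \<and> (\<forall>S\<subseteq>N. v S \<in> {0, 1}) \<and> v {} = 0 \<and> v N = 1 \<and>
     (\<forall>S T. S \<subseteq> T \<and> T \<subseteq> N \<longrightarrow> v S \<le> v T)"

text \<open>A pair \<open>(i, j)\<close> in this relation means that \<open>i\<close> is at least as desirable as \<open>j\<close>,
  so larger elements in the sense of desirability stand on the left.\<close>
definition desirability :: "('a set \<Rightarrow> nat) \<Rightarrow> 'a set \<Rightarrow> 'a rel" where
  "desirability v N = {(i, j). i \<in> N \<and> j \<in> N \<and>
     (\<forall>S. {j} \<subseteq> S \<and> S \<subseteq> N - {i} \<longrightarrow> v (({i} \<union> S) - {j}) \<ge> v S)}"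

definition equi_desirability :: "('a set \<Rightarrow> nat) \<Rightarrow> 'a set \<Rightarrow> 'a rel" where
  "equi_desirability v N = desirability v N \<inter> (desirability v N)\<inverse>"

definition complete_simple_game :: "('a set \<Rightarrow> nat) \<Rightarrow> 'a set \<Rightarrow> bool" where
  "complete_simple_game v N \<longleftrightarrow>
     simple_game v N \<and> preorder_on N (desirability v N) \<and> total_on N (desirability v N)"

text \<open>The list \<open>Ns\<close> enumerates the equivalence classes, each exactly once, from the most to the
  least desirable one.\<close>
definition has_type_composition :: "('a set \<Rightarrow> nat) \<Rightarrow> 'a set \<Rightarrow> nat list \<Rightarrow> bool" where
  "has_type_composition v N ns \<longleftrightarrow>
     (\<exists>Ns. distinct Ns \<and> set Ns = N // equi_desirability v N \<and>
       sorted_wrt (\<lambda>A B. \<forall>i\<in>A. \<forall>j\<in>B.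
         (i, j) \<in> desirability v N \<and> (j, i) \<notin> desirability v N) Ns \<and>
       ns = map card Ns)"

definition weighted :: "('a set \<Rightarrow> nat) \<Rightarrow> 'a set \<Rightarrow> bool" where
  "weighted v N \<longleftrightarrow>
     (\<exists>(w :: 'a \<Rightarrow> real) (q :: real). (\<forall>i\<in>N. w i \<ge> 0) \<and> q > 0 \<and>
       (\<forall>S\<subseteq>N. v S = 1 \<longleftrightarrow> (\<Sum>i\<in>S. w i) \<ge> q))"

end

theory Submission
  imports Defs
begin

text \<open>For a coalition \<open>S\<close> and a type \<open>c\<close>, count the members of \<open>S\<close> whose type is at least as desirable
  as \<open>c\<close>. Declaring a coalition winning if these counts are all at least those of one of finitely
  many generating coalitions yields a game in which an agent of a better type is always at least as
  desirable, and a strict difference between consecutive types is witnessed by a generator that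
  starts losing when one of its members is replaced by an agent of the next type. The game is not
  weighted once two generators \<open>A\<close>, \<open>B\<close> can trade members to become two losing coalitions \<open>C\<close>, \<open>D\<close>,
  since the total weight of \<open>A\<close> and \<open>B\<close> equals that of \<open>C\<close> and \<open>D\<close>.\<close>

lemma refl_desirability: "refl_on N (desirability v N)"
  by (auto simp: desirability_def intro: refl_onI)

text \<open>Putting \<open>i\<close> in place of \<open>k\<close> is done by two exchanges through
  \<open>j\<close>: if \<open>j\<close> lies in \<open>S\<close>, first \<open>i\<close> replaces
  \<open>j\<close> and then \<open>j\<close> replaces \<open>k\<close>; otherwise \<open>j\<close>
  replaces \<open>k\<close> and then \<open>i\<close> replaces \<open>j\<close>. Since
  \<open>v\<close> is arbitrary, completeness of a simple game amounts to totality.\<close>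

lemma trans_desirability: "trans (desirability v N)"
proof (rule transI)
  fix i j k
  assume ij: "(i, j) \<in> desirability v N" and jk: "(j, k) \<in> desirability v N"
  have *: "v S \<le> v ({i} \<union> S - {k})" if S: "{k} \<subseteq> S" "S \<subseteq> N - {i}" for S
  proof (cases "i = j \<or> j = k")
    case True
    then show ?thesis
      using ij jk S unfolding desirability_def by auto
  next
    case False
    have ij': "v T \<le> v ({i} \<union> T - {j})" if "{j} \<subseteq> T" "T \<subseteq> N - {i}" for T
      using ij that unfolding desirability_def by blast
    have jk': "v T \<le> v ({j} \<union> T - {k})" if "{k} \<subseteq> T" "T \<subseteq> N - {j}" for T
      using jk that unfolding desirability_def by blast
    have N: "i \<in> N" "j \<in> N" "k \<in> N"
      using ij jk by (auto simp: desirability_def)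
    have "i \<noteq> k" using S by auto
    show ?thesis
    proof (cases "j \<in> S")
      case True
      have "v S \<le> v ({i} \<union> S - {j})"
        using ij' True S by auto
      also have "\<dots> \<le> v ({j} \<union> ({i} \<union> S - {j}) - {k})"
        using S N False by (intro jk') auto
      also have "{j} \<union> ({i} \<union> S - {j}) - {k} = {i} \<union> S - {k}"
        using True by auto
      finally show ?thesis .
    next
      case jS: False
      have "v S \<le> v ({j} \<union> S - {k})"
        using jk' jS S by auto
      also have "\<dots> \<le> v ({i} \<union> ({j} \<union> S - {k}) - {j})"
        using S N False \<open>i \<noteq> k\<close> by (intro ij') auto
      also have "{i} \<union> ({j} \<union> S - {k}) - {j} = {i} \<union> S - {k}"
        using jS False \<open>i \<noteq> k\<close> by auto
      finally show ?thesis .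
    qed
  qed
  then show "(i, k) \<in> desirability v N"
    using ij jk by (auto simp: desirability_def)
qed

text \<open>By transitivity one strict pair for each two consecutive types is enough: if
  \<open>i\<close> of a worse type were at least as desirable as \<open>j\<close>, the chain
  \<open>b\<close>, \<open>i\<close>, \<open>j\<close>, \<open>a\<close> would contradict the strict
  pair \<open>a\<close>, \<open>b\<close> of types \<open>\<tau> j\<close> and
  \<open>Suc (\<tau> j)\<close>.\<close>

lemma desirability_eq_types:
  fixes \<tau> :: "'a \<Rightarrow> nat"
  assumes le: "\<And>i j. i \<in> N \<Longrightarrow> j \<in> N \<Longrightarrow> \<tau> i \<le> \<tau> j \<Longrightarrow> (i, j) \<in> desirability v N"
    and less: "\<And>k. Suc k < t \<Longrightarrow>
      \<exists>i\<in>N. \<exists>j\<in>N. \<tau> i = k \<and> \<tau> j = Suc k \<and> (j, i) \<notin> desirability v N"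
    and t: "\<tau> ` N \<subseteq> {..<t}"
  shows "desirability v N = {(i, j). i \<in> N \<and> j \<in> N \<and> \<tau> i \<le> \<tau> j}"
proof -
  have "\<tau> i \<le> \<tau> j" if ij: "(i, j) \<in> desirability v N" for i j
  proof (rule ccontr)
    assume "\<not> \<tau> i \<le> \<tau> j"
    have N: "i \<in> N" "j \<in> N"
      using ij by (auto simp: desirability_def)
    then have "Suc (\<tau> j) < t"
      using t \<open>\<not> \<tau> i \<le> \<tau> j\<close> by fastforce
    then obtain a b where ab: "a \<in> N" "b \<in> N" "\<tau> a = \<tau> j" "\<tau> b = Suc (\<tau> j)"
      "(b, a) \<notin> desirability v N"
      using less by blast
    have "(b, i) \<in> desirability v N" "(j, a) \<in> desirability v N"
      using le N ab \<open>\<not> \<tau> i \<le> \<tau> j\<close> by auto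
    then show False
      using ij ab(5) trans_desirability[of v N] by (meson transD)
  qed
  then show ?thesis
    using le by (auto simp: desirability_def)
qed

text \<open>The equivalence classes are the fibres of \<open>\<tau>\<close>. Surjectivity onto
  \<open>{..<t}\<close> makes them nonempty and hence distinct, and increasing type means decreasing
  desirability.\<close>

lemma has_type_composition_types:
  fixes \<tau> :: "'a \<Rightarrow> nat"
  assumes D: "desirability v N = {(i, j). i \<in> N \<and> j \<in> N \<and> \<tau> i \<le> \<tau> j}"
    and t: "\<tau> ` N = {..<t}"
  shows "has_type_composition v N (map (\<lambda>k. card {i \<in> N. \<tau> i = k}) [0..<t])"
proof -
  define B where "B k = {i \<in> N. \<tau> i = k}" for k
  have E: "equi_desirability v N = {(i, j). i \<in> N \<and> j \<in> N \<and> \<tau> i = \<tau> j}"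
    unfolding equi_desirability_def D by auto
  have nonempty: "B k \<noteq> {}" if "k < t" for k
  proof -
    have "k \<in> \<tau> ` N"
      using that t by simp
    then show ?thesis
      by (auto simp: B_def)
  qed
  have class_eq: "equi_desirability v N `` {i} = B (\<tau> i)" if "i \<in> N" for i
    using that by (auto simp: E B_def)
  have "N // equi_desirability v N = (\<lambda>i. B (\<tau> i)) ` N"
    using class_eq by (auto simp: quotient_def)
  also have "\<dots> = B ` {..<t}"
    using t by (metis image_image)
  finally have quot: "N // equi_desirability v N = B ` {..<t}" .
  have "inj_on B {..<t}"
    using nonempty by (fastforce simp: inj_on_def B_def)
  then have "distinct (map B [0..<t])"
    by (simp add: distinct_map atLeast0LessThan)
  moreover have "set (map B [0..<t]) = N // equi_desirability v N"
    by (simp add: quot atLeast0LessThan)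
  moreover have "sorted_wrt (\<lambda>A C. \<forall>i\<in>A. \<forall>j\<in>C.
      (i, j) \<in> desirability v N \<and> (j, i) \<notin> desirability v N) (map B [0..<t])"
    by (auto simp: sorted_wrt_iff_nth_less D B_def)
  moreover have "map (\<lambda>k. card {i \<in> N. \<tau> i = k}) [0..<t] = map card (map B [0..<t])"
    by (simp add: B_def)
  ultimately show ?thesis
    unfolding has_type_composition_def by blast
qed

text \<open>Equal unions and intersections say that every agent occurs in \<open>C\<close> and
  \<open>D\<close> together as often as in \<open>A\<close> and \<open>B\<close> together. The
  common total weight would be both at least \<open>2 * q\<close> and below it.\<close>

lemma not_weighted_if_trade:
  assumes "finite N" "A \<subseteq> N" "B \<subseteq> N" "v A = 1" "v B = 1" "v C \<noteq> 1" "v D \<noteq> 1"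
    and Un: "C \<union> D = A \<union> B" and Int: "C \<inter> D = A \<inter> B"
  shows "\<not> weighted v N"
proof
  assume "weighted v N"
  then obtain w :: "'a \<Rightarrow> real" and q where w: "\<And>S. S \<subseteq> N \<Longrightarrow> v S = 1 \<longleftrightarrow> sum w S \<ge> q"
    unfolding weighted_def by blast
  have CD: "C \<subseteq> N" "D \<subseteq> N"
    using assms by auto
  have "sum w A + sum w B = sum w C + sum w D"
    using sum.union_inter[of A B w] sum.union_inter[of C D w] Un Int
      finite_subset[OF _ \<open>finite N\<close>] assms(2,3) CD
    by simp
  moreover have "sum w A \<ge> q" "sum w B \<ge> q" "sum w C < q" "sum w D < q"
    using w assms CD by (auto simp: not_le[symmetric])
  ultimately show False
    by linarith
qed

text \<open>Testing the counts only at the types of members of \<open>A\<close> suffices, since at any other type the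
  count of \<open>A\<close> is zero or agrees with the one at a better type; this keeps the test executable.\<close>
definition shift_game :: "('a \<Rightarrow> nat) \<Rightarrow> 'a set set \<Rightarrow> 'a set \<Rightarrow> nat" where
  "shift_game \<tau> \<A> S = of_bool (\<exists>A\<in>\<A>. \<forall>a\<in>A.
     card {i \<in> A. \<tau> i \<le> \<tau> a} \<le> card {i \<in> S. \<tau> i \<le> \<tau> a})"

text \<open>Both monotonicity and desirability rest on this: neither adding an agent nor exchanging
  one for an agent of an equal or better type lowers a count.\<close>

lemma shift_game_le_if_counts_le:
  assumes "\<And>c. card {i \<in> S. \<tau> i \<le> c} \<le> card {i \<in> T. \<tau> i \<le> c}"
  shows "shift_game \<tau> \<A> S \<le> shift_game \<tau> \<A> T"
  using assms unfolding shift_game_def by (auto simp: of_bool_def) (meson le_trans)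

lemma shift_game_generator: "A \<in> \<A> \<Longrightarrow> shift_game \<tau> \<A> A = 1"
  unfolding shift_game_def by auto

lemma shift_game_mono:
  assumes "finite T" "S \<subseteq> T"
  shows "shift_game \<tau> \<A> S \<le> shift_game \<tau> \<A> T"
  using assms by (intro shift_game_le_if_counts_le card_mono) auto

lemma simple_game_shift_game:
  assumes "finite N" "\<A> \<noteq> {}" "{} \<notin> \<A>" "\<Union>\<A> \<subseteq> N"
  shows "simple_game (shift_game \<tau> \<A>) N"
proof -
  obtain A where A: "A \<in> \<A>"
    using assms by blast
  have "shift_game \<tau> \<A> A \<le> shift_game \<tau> \<A> N"
    using A assms by (intro shift_game_mono) auto
  then have "shift_game \<tau> \<A> N = 1"
    using A by (simp add: shift_game_generator) (simp add: shift_game_def of_bool_def split: if_splits)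
  moreover have "shift_game \<tau> \<A> {} = 0"
  proof -
    \<comment> \<open>A member of a generator is counted at its own type, where the empty coalition
      has count zero.\<close>
    have "\<exists>a\<in>A. card {i \<in> A. \<tau> i \<le> \<tau> a} > 0" if "A \<in> \<A>" for A
    proof -
      have "finite A" "A \<noteq> {}"
        using that assms finite_subset[of A N] by auto
      then show ?thesis
        by (force simp: card_gt_0_iff)
    qed
    then show ?thesis
      by (fastforce simp: shift_game_def)
  qed
  moreover have "shift_game \<tau> \<A> S \<in> {0, 1}" for S
    by (simp add: shift_game_def)
  ultimately show ?thesis
    unfolding simple_game_def using assms(1) shift_game_mono finite_subset by metis
qed

lemma shift_game_desirability:
  assumes "finite N" "i \<in> N" "j \<in> N" "\<tau> i \<le> \<tau> j"
  shows "(i, j) \<in> desirability (shift_game \<tau> \<A>) N"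
proof -
  have "shift_game \<tau> \<A> S \<le> shift_game \<tau> \<A> ({i} \<union> S - {j})"
    if S: "{j} \<subseteq> S" "S \<subseteq> N - {i}" for S
  proof (rule shift_game_le_if_counts_le)
    fix c
    let ?F = "{x \<in> S. \<tau> x \<le> c}"
    have fin: "finite S"
      using S assms(1) by (meson finite_Diff finite_subset)
    show "card ?F \<le> card {x \<in> {i} \<union> S - {j}. \<tau> x \<le> c}"
    \<comment> \<open>If \<open>j\<close> is counted, so is its replacement \<open>i\<close>, and
      the count is unchanged; otherwise removing \<open>j\<close> costs nothing.\<close>
    proof (cases "\<tau> j \<le> c")
      case True
      have "card ?F = card (insert i (?F - {j}))"
        using S fin True by (subst card.insert) (auto simp: card.remove[of ?F j] simp del: card_Diff_insert)
      also have "insert i (?F - {j}) = {x \<in> {i} \<union> S - {j}. \<tau> x \<le> c}"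
        using S assms(4) True by auto
      finally show ?thesis by simp
    next
      case False
      then show ?thesis
        using fin by (intro card_mono) auto
    qed
  qed
  then show ?thesis
    using assms by (auto simp: desirability_def)
qed

text \<open>The entry \<open>ts ! i\<close> is the type of agent \<open>i\<close>; types are numbered from \<open>0\<close>.\<close>
definition valid_data ::
  "nat list \<Rightarrow> nat list \<Rightarrow> nat set set \<Rightarrow> nat set \<Rightarrow> nat set \<Rightarrow> nat set \<Rightarrow> nat set \<Rightarrow> bool" where
  "valid_data ns ts \<A> A B C D \<longleftrightarrow>
     ns = map (\<lambda>k. card {i \<in> {..<length ts}. ts ! i = k}) [0..<length ns] \<and>
     set ts = {..<length ns} \<and>
     \<A> \<noteq> {} \<and> {} \<notin> \<A> \<and> \<Union>\<A> \<subseteq> {..<length ts} \<and>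
     (\<forall>k \<in> {..<length ns - 1}. \<exists>S\<in>\<A>. \<exists>i\<in>S. \<exists>j\<in>{..<length ts} - S. ts ! i = k \<and> ts ! j = Suc k \<and>
        shift_game ((!) ts) \<A> ({j} \<union> S - {i}) = 0) \<and>
     A \<in> \<A> \<and> B \<in> \<A> \<and> C \<union> D = A \<union> B \<and> C \<inter> D = A \<inter> B \<and>
     shift_game ((!) ts) \<A> C = 0 \<and> shift_game ((!) ts) \<A> D = 0"

text \<open>This reduces the theorem to finite checks: the losing exchanges separate consecutive
  types, and \<open>A\<close>, \<open>B\<close>, \<open>C\<close>, \<open>D\<close> form the trade
  that rules out weights.\<close>

lemma exists_game_if_valid_data:
  assumes "valid_data ns ts \<A> A B C D"
  shows "\<exists>(v :: nat set \<Rightarrow> nat) (N :: nat set).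
    complete_simple_game v N \<and> \<not> weighted v N \<and> has_type_composition v N ns"
proof -
  define N where "N = {..<length ts}"
  define \<tau> where "\<tau> = (!) ts"
  define v where "v = shift_game \<tau> \<A>"
  note defs = N_def \<tau>_def v_def
  have ns: "ns = map (\<lambda>k. card {i \<in> N. \<tau> i = k}) [0..<length ns]"
    and "set ts = {..<length ns}" and gen: "\<A> \<noteq> {}" "{} \<notin> \<A>" "\<Union>\<A> \<subseteq> N"
    and step: "\<And>k. k < length ns - 1 \<Longrightarrow> \<exists>S\<in>\<A>. \<exists>i\<in>S. \<exists>j\<in>N - S.
        \<tau> i = k \<and> \<tau> j = Suc k \<and> v ({j} \<union> S - {i}) = 0"
    and trade: "A \<in> \<A>" "B \<in> \<A>" "C \<union> D = A \<union> B" "C \<inter> D = A \<inter> B" "v C = 0" "v D = 0"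
    using assms unfolding valid_data_def defs by auto
  have \<tau>: "\<tau> ` N = {..<length ns}"
    using \<open>set ts = _\<close> by (auto simp: defs set_conv_nth)
  have simple: "simple_game v N"
    using gen unfolding v_def by (intro simple_game_shift_game) (auto simp: N_def)
  have D: "desirability v N = {(i, j). i \<in> N \<and> j \<in> N \<and> \<tau> i \<le> \<tau> j}"
  proof (rule desirability_eq_types[where t = "length ns"])
    show "(i, j) \<in> desirability v N" if "i \<in> N" "j \<in> N" "\<tau> i \<le> \<tau> j" for i j
      using that unfolding v_def by (intro shift_game_desirability) (auto simp: N_def)
  next
    fix k assume "Suc k < length ns"
    then obtain S i j where S: "S \<in> \<A>" "i \<in> S" "j \<in> N - S" "\<tau> i = k" "\<tau> j = Suc k"
      "v ({j} \<union> S - {i}) = 0"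
      using step[of k] by fastforce
    have "v S = 1"
      using S(1) by (simp add: v_def shift_game_generator)
    moreover have "{i} \<subseteq> S" "S \<subseteq> N - {j}"
      using S gen by auto
    ultimately have "\<not> (\<forall>S. {i} \<subseteq> S \<and> S \<subseteq> N - {j} \<longrightarrow> v ({j} \<union> S - {i}) \<ge> v S)"
      using S(6) by (metis not_one_le_zero)
    then have "(j, i) \<notin> desirability v N"
      by (simp add: desirability_def)
    then show "\<exists>i\<in>N. \<exists>j\<in>N. \<tau> i = k \<and> \<tau> j = Suc k \<and> (j, i) \<notin> desirability v N"
      using S gen by blast
  qed (simp add: \<tau>)
  have "total_on N (desirability v N)"
    by (auto simp: total_on_def D)
  moreover have "preorder_on N (desirability v N)"
    using refl_desirability trans_desirability
    by (auto simp: preorder_on_def desirability_def)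
  ultimately have "complete_simple_game v N"
    using simple by (simp add: complete_simple_game_def)
  moreover have "\<not> weighted v N"
    using trade gen shift_game_generator[of _ \<A> \<tau>]
    by (intro not_weighted_if_trade[of N A B v C D]) (auto simp: defs)
  moreover have "has_type_composition v N ns"
    by (subst ns) (rule has_type_composition_types[OF D \<tau>])
  ultimately show ?thesis by blast
qed

text \<open>The two traded generators suffice except for \<open>[2,1,4]\<close> and
  \<open>[1,1,1,1,2]\<close>. There a third one separates types 1 and 2, because the sole agent of
  type 1 is in neither of the two, respectively only together with the sole agent of type 2.\<close>

lemma valid_data_instances:
  shows
    "valid_data [2,4] [0,0,1,1,1,1] {{0,2,3}, {1,4,5}}
      {0,2,3} {1,4,5} {2,3,4,5} {0,1}"
    "valid_data [2,2,2] [0,0,1,1,2,2] {{0,2,4}, {1,3,5}}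
      {0,2,4} {1,3,5} {0,1} {2,3,4,5}"
    "valid_data [1,1,5] [0,1,2,2,2,2,2] {{1,2,3,4}, {0,5,6}}
      {1,2,3,4} {0,5,6} {0,1} {2,3,4,5,6}"
    "valid_data [1,2,3] [0,1,1,2,2,2] {{1,3,4,5}, {0,2}}
      {1,3,4,5} {0,2} {1,2,3} {0,4,5}"
    "valid_data [1,3,2] [0,1,1,1,2,2] {{1,2,4,5}, {0,3}}
      {1,2,4,5} {0,3} {1,2,3} {0,4,5}"
    "valid_data [2,1,4] [0,0,1,2,2,2,2] {{0,3,4}, {1,5,6}, {2,3,4,5}}
      {0,3,4} {1,5,6} {3,4,5,6} {0,1}"
    "valid_data [2,4,1] [0,0,1,1,1,1,2] {{0,2,3}, {1,4,5}}
      {0,2,3} {1,4,5} {2,3,4,5} {0,1}"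
    "valid_data [1,1,1,3] [0,1,2,3,3,3] {{1,3,4,5}, {0,2}}
      {1,3,4,5} {0,2} {1,2,3} {0,4,5}"
    "valid_data [1,1,3,1] [0,1,2,2,2,3] {{1,2,3}, {0,4,5}}
      {1,2,3} {0,4,5} {0,1} {2,3,4,5}"
    "valid_data [2,1,2,1] [0,0,1,2,2,3] {{0,3,4}, {1,2,5}}
      {0,3,4} {1,2,5} {2,3,4,5} {0,1}"
    "valid_data [2,3,1,1] [0,0,1,1,1,2,3] {{2,3,4,6}, {0,1,5}}
      {2,3,4,6} {0,1,5} {0,2,5,6} {1,3,4}"
    "valid_data [1,2,2,1] [0,1,1,2,2,3] {{1,2,5}, {0,3,4}}
      {1,2,5} {0,3,4} {1,3,4,5} {0,2}"
    "valid_data [1,2,1,2] [0,1,1,2,3,3] {{1,2,4}, {0,3,5}}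
      {1,2,4} {0,3,5} {0,1} {2,3,4,5}"
    "valid_data [1,1,2,2] [0,1,2,2,3,3] {{1,2,4,5}, {0,3}}
      {1,2,4,5} {0,3} {0,4,5} {1,2,3}"
    "valid_data [1,2,1,1,1] [0,1,1,2,3,4] {{1,2,4}, {0,3,5}}
      {1,2,4} {0,3,5} {1,3,4,5} {0,2}"
    "valid_data [1,1,2,1,1] [0,1,2,2,3,4] {{1,2,4}, {0,3,5}}
      {1,2,4} {0,3,5} {0,1} {2,3,4,5}"
    "valid_data [1,1,1,2,1] [0,1,2,3,3,4] {{1,3,4}, {0,2,5}}
      {1,3,4} {0,2,5} {0,1} {2,3,4,5}"
    "valid_data [1,1,1,1,2] [0,1,2,3,4,4] {{1,2,4}, {0,3,5}, {1,3,4,5}}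
      {1,2,4} {0,3,5} {0,1} {2,3,4,5}"
  \<comment> \<open>All quantifiers range over explicit finite sets, so each instance is decided by
    evaluation.\<close>
  by code_simp+

theorem lemma5:
  fixes ns :: "nat list"
  assumes "ns \<in> {
    [2,4], [2,2,2], [1,1,5], [1,2,3], [1,3,2], [2,1,4], [2,4,1],
    [1,1,1,3], [1,1,3,1], [2,1,2,1], [2,3,1,1], [1,2,2,1], [1,2,1,2], [1,1,2,2],
    [1,2,1,1,1], [1,1,2,1,1], [1,1,1,2,1], [1,1,1,1,2]}"
  shows "\<exists>(v :: nat set \<Rightarrow> nat) (N :: nat set).
    complete_simple_game v N \<and> \<not> weighted v N \<and> has_type_composition v N ns"
  using assms valid_data_instances[THEN exists_game_if_valid_data]
  by (elim insertE emptyE) (simp only:)+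

end
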